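(* The sequence $(\nu_2(F_{n+1}))_{n \geq 0}$ is a $2$-regular sequence of rank $5$.
   Context: $F_n$ denotes the $n$th Fibonacci number: $F_1 = F_2 = 1$ and $F_{n+2} = F_{n+1} + F_n$ for $n \geq 1$. For a prime $p$ and an integer $n \geq 1$, $\nu_p(n)$ is the exponent of the highest power of $p$ dividing $n$ (the $p$-adic valuation). For an integer $k \geq 2$, the $k$-kernel of a sequence $s(n)_{n \geq 0}$ is the set of sequences $\ker_k s(n)_{n\ge 0} = \{ s(k^e n + i)_{n \geq 0} : e \geq 0,\ 0 \leq i \leq k^e - 1 \}$. The sequence $s(n)_{n \geq 0}$ is $k$-regular if the $\mathbb{Z}$-module $\langle \ker_k s(n)_{n\ge 0} \rangle$ generated by its $k$-kernel (under termwise operations) is finitely generated. The rank of a $k$-regular sequence is the rank of this $\mathbb{Z}$-module (the maximal number of $\mathbb{Z}$-linearly independent elements). *)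

theory Defs
  imports
    "HOL-Library.Function_Algebras"
    "HOL-Library.Extended_Nat"
    "HOL-Number_Theory.Fib"
    "HOL-Computational_Algebra.Primes"
begin

definition seq_scale :: "int \<Rightarrow> (nat \<Rightarrow> int) \<Rightarrow> nat \<Rightarrow> int" where
  "seq_scale c s = (\<lambda>n. c * s n)"

text \<open>Addition, negation and zero of sequences are the pointwise ones of
  \<^theory>\<open>HOL-Library.Function_Algebras\<close>.\<close>

global_interpretation int_seq: module seq_scale
  by unfold_locales (auto simp: seq_scale_def algebra_simps)

definition k_kernel :: "nat \<Rightarrow> (nat \<Rightarrow> int) \<Rightarrow> (nat \<Rightarrow> int) set" where
  "k_kernel k s = {(\<lambda>n. s (k ^ e * n + i)) | e i. i \<le> k ^ e - 1}"

definition kernel_module :: "nat \<Rightarrow> (nat \<Rightarrow> int) \<Rightarrow> (nat \<Rightarrow> int) set" where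
  "kernel_module k s = int_seq.span (k_kernel k s)"

definition k_regular :: "nat \<Rightarrow> (nat \<Rightarrow> int) \<Rightarrow> bool" where
  "k_regular k s \<longleftrightarrow> k \<ge> 2 \<and> (\<exists>B. finite B \<and> int_seq.span B = kernel_module k s)"

text \<open>Linear independence is over the integers (no nontrivial integer relation). The supremum
  is taken in \<^typ>\<open>enat\<close>, so that it is \<open>\<infinity>\<close>, not a junk value, when the sizes of independent
  subsets are unbounded.\<close>

definition module_rank :: "(nat \<Rightarrow> int) set \<Rightarrow> enat" where
  "module_rank M = (SUP B \<in> {B. B \<subseteq> M \<and> finite B \<and> int_seq.independent B}. enat (card B))"

definition seq_rank :: "nat \<Rightarrow> (nat \<Rightarrow> int) \<Rightarrow> enat" where
  "seq_rank k s = module_rank (kernel_module k s)"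

end

theory Submission
  imports Defs
begin

text \<open>Write \<open>s(n) = \<nu>\<^sub>2(F\<^bsub>n+1\<^esub>)\<close>, \<open>t(n) = s(2n+1)\<close> and let \<open>e\<^sub>j\<close> be the indicator
  sequence of the residue class of \<open>j\<close> modulo 3. From \<open>F\<^bsub>2m\<^esub> = F\<^sub>m L\<^sub>m\<close> with
  \<open>L\<^sub>m = 2F\<^bsub>m+1\<^esub> - F\<^sub>m\<close> and the congruence
  \<open>F\<^bsub>m+12\<^esub> \<equiv> 9F\<^sub>m\<close> modulo 16 one gets
  \<open>s(2n) = e\<^sub>1(n)\<close>, \<open>t(2n) = 3e\<^sub>1(n)\<close> and \<open>t(2n+1) = t(n) + e\<^sub>2(n)\<close>. Hence the module generated by
  \<open>s, t, e\<^sub>0, e\<^sub>1, e\<^sub>2\<close> is closed under \<open>n \<mapsto> 2n\<close> and \<open>n \<mapsto> 2n+1\<close>, and its generators all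
  lie in the kernel and are linearly independent.\<close>

section \<open>Rank of finitely generated modules of sequences\<close>

text \<open>Fraction-free Gaussian elimination, removing one equation and one unknown at a time; no
  division occurs, so it works over the integers.\<close>

lemma homogeneous_system_nontrivial_solution:
  fixes A :: "'a \<Rightarrow> 'b \<Rightarrow> 'c::idom"
  assumes "finite J" "finite I" "card J < card I"
  shows "\<exists>c. (\<exists>i\<in>I. c i \<noteq> 0) \<and> (\<forall>j\<in>J. (\<Sum>i\<in>I. c i * A i j) = 0)"
  using assms
proof (induction J arbitrary: I A rule: finite_induct)
  case empty
  then obtain i where "i \<in> I" by fastforce
  then show ?case by (intro exI[of _ "\<lambda>_. 1"]) auto
next
  case (insert j J)
  show ?case
  proof (cases "\<forall>i\<in>I. A i j = 0")
    case True
    have "card J < card I" using insert by simp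
    from insert.IH[OF insert.prems(1) this] obtain c where
      "\<exists>i\<in>I. c i \<noteq> 0" "\<forall>k\<in>J. (\<Sum>i\<in>I. c i * A i k) = 0" by blast
    with True show ?thesis by (intro exI[of _ c]) auto
  next
    case False
    then obtain p where p: "p \<in> I" "A p j \<noteq> 0" by blast
    define I' where "I' = I - {p}"
    have I: "I = insert p I'" "p \<notin> I'" "finite I'"
      using p insert.prems by (auto simp: I'_def)
    have "card J < card I'" using insert I by simp
    \<comment> \<open>Cross-multiplying with the pivot \<open>A p j\<close> clears equation
      \<open>j\<close> from every other row.\<close>
    from insert.IH[OF I(3) this, of "\<lambda>i k. A p j * A i k - A i j * A p k"] obtain c where
      c: "\<exists>i\<in>I'. c i \<noteq> 0"
      "\<And>k. k \<in> J \<Longrightarrow> (\<Sum>i\<in>I'. c i * (A p j * A i k - A i j * A p k)) = 0" by blast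
    \<comment> \<open>Back substitution: the old solution is scaled by the pivot, and the entry at
      \<open>p\<close> is chosen so that equation \<open>j\<close> holds. Scaling by
      \<open>A p j\<close> keeps a nonzero entry nonzero in a domain.\<close>
    define d where "d i = (if i = p then - (\<Sum>i\<in>I'. c i * A i j) else c i * A p j)" for i
    have sum_d: "(\<Sum>i\<in>I. d i * A i k)
        = (\<Sum>i\<in>I'. c i * (A p j * A i k - A i j * A p k))" for k
    proof -
      have "(\<Sum>i\<in>I'. d i * A i k) = (\<Sum>i\<in>I'. c i * A p j * A i k)"
        using I(2) by (intro sum.cong) (auto simp: d_def)
      then show ?thesis
        using I(2,3) unfolding I(1)
        by (simp add: d_def sum_distrib_left sum_subtractf algebra_simps)
    qed
    have "(\<Sum>i\<in>I. d i * A i j) = 0"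
      unfolding sum_d by (simp add: mult.commute)
    moreover have "\<exists>i\<in>I. d i \<noteq> 0"
      using c(1) p I by (auto simp: d_def)
    ultimately show ?thesis
      using c(2) sum_d by (intro exI[of _ d]) auto
  qed
qed

text \<open>If \<open>B\<close> were larger than \<open>G\<close>, the coefficients of its elements
  over \<open>G\<close> would form a system with more unknowns than equations; a nontrivial solution
  is a relation on \<open>B\<close>.\<close>

lemma card_independent_le_card_generators:
  assumes G: "finite G" and B: "finite B" "B \<subseteq> int_seq.span G" "int_seq.independent B"
  shows "card B \<le> card G"
proof (rule ccontr)
  assume "\<not> card B \<le> card G"
  have "\<forall>b\<in>B. \<exists>u. b = (\<Sum>g\<in>G. seq_scale (u g) g)"
    using B(2) int_seq.span_finite[OF G] by auto
  then obtain A where A: "\<And>b. b \<in> B \<Longrightarrow> b = (\<Sum>g\<in>G. seq_scale (A b g) g)"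
    by metis
  obtain c where c: "\<exists>b\<in>B. c b \<noteq> 0" "\<And>g. g \<in> G \<Longrightarrow> (\<Sum>b\<in>B. c b * A b g) = 0"
    using homogeneous_system_nontrivial_solution[OF G B(1), of A] \<open>\<not> card B \<le> card G\<close> by auto
  have "(\<Sum>b\<in>B. seq_scale (c b) b)
      = (\<Sum>b\<in>B. seq_scale (c b) (\<Sum>g\<in>G. seq_scale (A b g) g))"
    using A by (intro sum.cong) auto
  also have "\<dots> = (\<Sum>b\<in>B. \<Sum>g\<in>G. seq_scale (c b * A b g) g)"
    by (simp add: int_seq.scale_sum_right)
  also have "\<dots> = (\<Sum>g\<in>G. seq_scale (\<Sum>b\<in>B. c b * A b g) g)"
    by (subst sum.swap) (simp add: int_seq.scale_sum_left)
  also have "\<dots> = 0"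
    using c(2) by simp
  finally show False
    using B(1,3) c(1) unfolding int_seq.dependent_explicit by blast
qed

lemma module_rank_span:
  assumes "finite G" "int_seq.independent G"
  shows "module_rank (int_seq.span G) = enat (card G)"
  unfolding module_rank_def
proof (rule antisym)
  show "(SUP B\<in>{B. B \<subseteq> int_seq.span G \<and> finite B \<and> int_seq.independent B}. enat (card B))
      \<le> enat (card G)"
    using card_independent_le_card_generators[OF assms(1)] by (intro SUP_least) auto
  show "enat (card G)
      \<le> (SUP B\<in>{B. B \<subseteq> int_seq.span G \<and> finite B \<and> int_seq.independent B}. enat (card B))"
    using assms int_seq.span_superset by (intro SUP_upper) auto
qed

section \<open>Decimation and the kernel\<close>

lemma span_decimation_closed:
  assumes "f \<in> int_seq.span G" "\<And>g. g \<in> G \<Longrightarrow> (\<lambda>n. g (k * n + j)) \<in> int_seq.span G"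
  shows "(\<lambda>n. f (k * n + j)) \<in> int_seq.span G"
  using assms(1)
proof (induction rule: int_seq.span_induct)
  case base
  \<comment> \<open>Decimation is linear, so the sequences whose decimation lies in the span form a
    submodule, and checking generators suffices.\<close>
  have "(\<lambda>n. 0) = (0 :: nat \<Rightarrow> int)" by auto
  moreover have "(\<lambda>n. (x + y) (k * n + j)) = (\<lambda>n. x (k * n + j)) + (\<lambda>n. y (k * n + j))"
    for x y :: "nat \<Rightarrow> int" by auto
  moreover have "(\<lambda>n. seq_scale c x (k * n + j)) = seq_scale c (\<lambda>n. x (k * n + j))"
    for c x by (auto simp: seq_scale_def)
  ultimately show ?case
    unfolding int_seq.subspace_def
    by (auto simp only: mem_Collect_eq intro!: int_seq.span_add int_seq.span_scale)
       (simp add: int_seq.span_zero)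
next
  case (step x)
  then show ?case by (rule assms(2))
qed

text \<open>Induction on \<open>e\<close>: decimating by the lowest base-\<open>k\<close> digit
  \<open>i mod k\<close> leaves a sequence of the span and the shorter index
  \<open>i div k\<close>.\<close>

lemma k_kernel_subset_span:
  assumes "k > 0" "f \<in> int_seq.span G"
    "\<And>g j. g \<in> G \<Longrightarrow> j < k \<Longrightarrow> (\<lambda>n. g (k * n + j)) \<in> int_seq.span G"
  shows "k_kernel k f \<subseteq> int_seq.span G"
proof -
  have "(\<lambda>n. f (k ^ e * n + i)) \<in> int_seq.span G" if "i < k ^ e" for e i
    using assms(2) that
  proof (induction e arbitrary: f i)
    case 0
    then show ?case by simp
  next
    case (Suc e)
    have "(\<lambda>n. f (k * n + i mod k)) \<in> int_seq.span G"
      using Suc.prems(1) by (rule span_decimation_closed) (use assms(1,3) in simp)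
    moreover have "i div k < k ^ e"
      using Suc.prems(2) assms(1) by (simp add: div_less_iff_less_mult mult.commute)
    ultimately have "(\<lambda>n. f (k * (k ^ e * n + i div k) + i mod k)) \<in> int_seq.span G"
      by (rule Suc.IH)
    moreover have "k * (k ^ e * n + i div k) + i mod k = k ^ Suc e * n + i" for n
      by (simp add: distrib_left mult.assoc add.assoc)
    ultimately show ?case by simp
  qed
  moreover have "i \<le> k ^ e - 1 \<longleftrightarrow> i < k ^ e" for i e
    using zero_less_power[OF assms(1), of e] by linarith
  ultimately show ?thesis
    by (auto simp: k_kernel_def)
qed

section \<open>The 2-adic valuation of Fibonacci numbers\<close>

lemma fib_values:
  "fib 3 = 2" "fib 4 = 3" "fib 5 = 5" "fib 6 = 8" "fib 7 = 13"
  "fib 8 = 21" "fib 9 = 34" "fib 10 = 55" "fib 11 = 89" "fib 12 = 144"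
proof -
  have v3: "fib 3 = 2" by (simp add: numeral_3_eq_3)
  have v4: "fib 4 = 3" using fib_plus_2[of 2] by (simp add: v3)
  have v5: "fib 5 = 5" using fib_plus_2[of 3] by (simp add: v4 v3)
  have v6: "fib 6 = 8" using fib_plus_2[of 4] by (simp add: v5 v4)
  have v7: "fib 7 = 13" using fib_plus_2[of 5] by (simp add: v6 v5)
  have v8: "fib 8 = 21" using fib_plus_2[of 6] by (simp add: v7 v6)
  have v9: "fib 9 = 34" using fib_plus_2[of 7] by (simp add: v8 v7)
  have v10: "fib 10 = 55" using fib_plus_2[of 8] by (simp add: v9 v8)
  have v11: "fib 11 = 89" using fib_plus_2[of 9] by (simp add: v10 v9)
  have v12: "fib 12 = 144" using fib_plus_2[of 10] by (simp add: v11 v10)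
  show "fib 3 = 2" "fib 4 = 3" "fib 5 = 5" "fib 6 = 8" "fib 7 = 13"
    "fib 8 = 21" "fib 9 = 34" "fib 10 = 55" "fib 11 = 89" "fib 12 = 144"
    by (fact v3 v4 v5 v6 v7 v8 v9 v10 v11 v12)+
qed

text \<open>The coefficients are \<open>fib 11\<close> and \<open>fib 12\<close>. The shift fixes
  \<open>fib n\<close> modulo 8 and multiplies it by 9 modulo 16.\<close>

lemma fib_add_12: "fib (n + 12) = 89 * fib n + 144 * fib (n + 1)"
  using fib_add[of n 11] fib_values by (simp add: algebra_simps)

text \<open>Induction in steps of 12 from the first twelve values. The claims modulo 2 and 4 survive
  the shift by invariance modulo 8, the last one because 9 * 8 is again 8 modulo 16.\<close>

lemma fib_mod_cases:
  "(\<not> 3 dvd m \<longrightarrow> odd (fib m)) \<and> (m mod 6 = 3 \<longrightarrow> fib m mod 4 = 2)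
    \<and> (6 dvd m \<longrightarrow> 4 dvd fib m) \<and> (m mod 12 = 6 \<longrightarrow> fib m mod 16 = 8)"
proof (induction m rule: less_induct)
  case (less m)
  show ?case
  proof (cases "m < 12")
    case True
    then have "m = 0 \<or> m = 1 \<or> m = 2 \<or> m = 3 \<or> m = 4 \<or> m = 5 \<or> m = 6 \<or> m = 7 \<or> m = 8
      \<or> m = 9 \<or> m = 10 \<or> m = 11"
      by (auto simp: less_Suc_eq numeral_eq_Suc)
    then show ?thesis
      by (elim disjE) (simp_all add: fib_values)
  next
    case False
    define n where "n = m - 12"
    have m: "m = n + 12" using False by (simp add: n_def)
    have residues: "3 dvd m \<longleftrightarrow> 3 dvd n" "6 dvd m \<longleftrightarrow> 6 dvd n" "m mod 6 = n mod 6" "m mod 12 = n mod 12"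
      using mod_mult_self1[of n 2 6] unfolding m by (simp_all add: dvd_add_left_iff)
    have fib_m: "fib m = fib n + 8 * (11 * fib n + 18 * fib (n + 1))"
      unfolding m fib_add_12 by simp
    have parity: "odd (fib n) \<Longrightarrow> odd (fib m)"
      unfolding fib_m by simp
    have mod_4: "fib m mod 4 = fib n mod 4"
    proof -
      have "fib m = fib n + 4 * (2 * (11 * fib n + 18 * fib (n + 1)))"
        unfolding fib_m by simp
      then show ?thesis by (simp only: mod_mult_self2)
    qed
    then have dvd_4: "4 dvd fib m \<longleftrightarrow> 4 dvd fib n"
      by (simp only: dvd_eq_mod_eq_0)
    have mod_16: "fib m mod 16 = 8" if "fib n mod 16 = 8"
    proof -
      define q where "q = fib n div 16"
      have "fib n = 16 * q + 8" using that by (metis mult_div_mod_eq q_def)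
      \<comment> \<open>Here 89 * 8 = 16 * 44 + 8 and 144 = 16 * 9.\<close>
      then have "fib m = 8 + 16 * (89 * q + 44 + 9 * fib (n + 1))"
        unfolding m fib_add_12 by simp
      then show ?thesis by (simp only: mod_mult_self2) simp
    qed
    have "n < m" using m by simp
    from less.IH[OF this] parity mod_16 show ?thesis
      unfolding residues mod_4 dvd_4 by blast
  qed
qed

lemma odd_fib: "\<not> 3 dvd m \<Longrightarrow> odd (fib m)"
  and fib_mod_4: "m mod 6 = 3 \<Longrightarrow> fib m mod 4 = 2"
  and four_dvd_fib: "6 dvd m \<Longrightarrow> 4 dvd fib m"
  and fib_mod_16: "m mod 12 = 6 \<Longrightarrow> fib m mod 16 = 8"
  using fib_mod_cases[of m] by blast+

section \<open>Valuations along residue classes of the index\<close>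

lemma multiplicity_2_eq_1: "(x::nat) mod 4 = 2 \<Longrightarrow> multiplicity 2 x = 1"
  by (rule multiplicity_eqI) (auto, presburger+)

lemma multiplicity_2_eq_3: "(x::nat) mod 16 = 8 \<Longrightarrow> multiplicity 2 x = 3"
  by (rule multiplicity_eqI) (auto, presburger+)

lemma multiplicity_fib_odd:
  "multiplicity 2 (fib (2 * n + 1)) = (if n mod 3 = 1 then 1 else 0)"
proof (cases "n mod 3 = 1")
  case True
  then have "(2 * n + 1) mod 6 = 3" by presburger
  with True show ?thesis by (simp only: fib_mod_4 multiplicity_2_eq_1) simp
next
  case False
  then have "\<not> 3 dvd 2 * n + 1" by presburger
  with False show ?thesis
    by (simp only: odd_fib not_dvd_imp_multiplicity_0 if_False not_False_eq_True)
qed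

lemma multiplicity_fib_4n_2:
  "multiplicity 2 (fib (4 * n + 2)) = (if n mod 3 = 1 then 3 else 0)"
proof (cases "n mod 3 = 1")
  case True
  then have "(4 * n + 2) mod 12 = 6" by presburger
  with True show ?thesis by (simp only: fib_mod_16 multiplicity_2_eq_3) simp
next
  case False
  then have "\<not> 3 dvd 4 * n + 2" by presburger
  with False show ?thesis
    by (simp only: odd_fib not_dvd_imp_multiplicity_0 if_False not_False_eq_True)
qed

lemma multiplicity_fib_4n_4:
  "multiplicity 2 (fib (4 * n + 4)) = multiplicity 2 (fib (2 * n + 2)) + (if n mod 3 = 2 then 1 else 0)"
proof -
  \<comment> \<open>The Lucas number of index \<open>2 * n + 2\<close>.\<close>
  define L where "L = fib (2 * n + 1) + fib (2 * n + 3)"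
  \<comment> \<open>This form avoids subtraction on naturals and yields \<open>L\<close> modulo 2
    and 4 from the two Fibonacci numbers.\<close>
  have L_alt: "L + fib (2 * n + 2) = 2 * fib (2 * n + 3)"
    by (simp add: L_def numeral_eq_Suc)
  have "fib (4 * n + 4) = fib (2 * n + 2) * L"
  proof -
    have "4 * n + 4 = 2 * (2 * n + 2)" "2 * n + 2 - 1 = 2 * n + 1" "2 * n + 2 + 1 = 2 * n + 3"
      by simp_all
    then show ?thesis
      using fib_rec_even[of "2 * n + 2"] by (simp only: L_def mult.commute)
  qed
  \<comment> \<open>Additivity of the valuation on a product requires nonzero factors.\<close>
  moreover have "fib (2 * n + 2) > 0" "L > 0"
    by (auto simp: L_def intro!: fib_neq_0_nat add_pos_pos)
  ultimately have "multiplicity 2 (fib (4 * n + 4))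
      = multiplicity 2 (fib (2 * n + 2)) + multiplicity 2 L"
    by (simp add: prime_elem_multiplicity_mult_distrib)
  also have "multiplicity 2 L = (if n mod 3 = 2 then 1 else 0)"
  proof (cases "n mod 3 = 2")
    case True
    then have "6 dvd 2 * n + 2" "\<not> 3 dvd 2 * n + 3" by presburger+
    then have "4 dvd fib (2 * n + 2)" "odd (fib (2 * n + 3))"
      by (simp_all only: four_dvd_fib odd_fib not_False_eq_True)
    with L_alt have "L mod 4 = 2" by presburger
    with True show ?thesis by (simp add: multiplicity_2_eq_1)
  next
    case False
    then have "\<not> 3 dvd 2 * n + 2" by presburger
    then have "odd (fib (2 * n + 2))" by (rule odd_fib)
    with L_alt have "odd L" by presburger
    with False show ?thesis by (simp add: not_dvd_imp_multiplicity_0)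
  qed
  finally show ?thesis .
qed

section \<open>The kernel of the valuation sequence\<close>

text \<open>The shift by one keeps out \<open>fib 0 = 0\<close>, whose \<open>multiplicity\<close>
  would be a mere default value.\<close>

definition fib_val :: "nat \<Rightarrow> int" where
  "fib_val n = int (multiplicity 2 (fib (n + 1)))"

definition residue_ind :: "nat \<Rightarrow> nat \<Rightarrow> int" where
  "residue_ind j n = (if n mod 3 = j then 1 else 0)"

text \<open>Found by closing \<open>fib_val\<close> under decimation: \<open>residue_ind 1\<close>
  is its even half, whose own halves are \<open>residue_ind 2\<close> and
  \<open>residue_ind 0\<close>.\<close>

definition fib_val_gens :: "(nat \<Rightarrow> int) set" where
  "fib_val_gens =
    {fib_val, \<lambda>n. fib_val (2 * n + 1), residue_ind 0, residue_ind 1, residue_ind 2}"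

lemma fib_val_even: "fib_val (2 * n) = residue_ind 1 n"
  using multiplicity_fib_odd[of n] by (simp add: fib_val_def residue_ind_def)

lemma fib_val_4n_1: "fib_val (4 * n + 1) = 3 * residue_ind 1 n"
  using multiplicity_fib_4n_2[of n] by (simp add: fib_val_def residue_ind_def)

lemma fib_val_4n_3: "fib_val (4 * n + 3) = fib_val (2 * n + 1) + residue_ind 2 n"
  using multiplicity_fib_4n_4[of n] by (simp add: fib_val_def residue_ind_def add.commute)

text \<open>Since 2 is invertible modulo 3, both index maps permute the residue classes.\<close>

lemma residue_ind_decimation:
  "residue_ind 0 (2 * n) = residue_ind 0 n" "residue_ind 0 (2 * n + 1) = residue_ind 1 n"
  "residue_ind 1 (2 * n) = residue_ind 2 n" "residue_ind 1 (2 * n + 1) = residue_ind 0 n"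
  "residue_ind 2 (2 * n) = residue_ind 1 n" "residue_ind 2 (2 * n + 1) = residue_ind 2 n"
  by (simp_all only: residue_ind_def) presburger+

lemma fib_val_gens_decimation:
  assumes "g \<in> fib_val_gens" "j < 2"
  shows "(\<lambda>n. g (2 * n + j)) \<in> int_seq.span fib_val_gens"
proof -
  have base: "fib_val \<in> int_seq.span fib_val_gens"
    "(\<lambda>n. fib_val (2 * n + 1)) \<in> int_seq.span fib_val_gens"
    "residue_ind 0 \<in> int_seq.span fib_val_gens"
    "residue_ind 1 \<in> int_seq.span fib_val_gens"
    "residue_ind 2 \<in> int_seq.span fib_val_gens"
    by (auto simp: fib_val_gens_def intro: int_seq.span_base)
  \<comment> \<open>Only the two decimations of the odd half are proper combinations; all others are
    again generators.\<close>
  have "(\<lambda>n. fib_val (2 * (2 * n) + 1)) = seq_scale 3 (residue_ind 1)"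
    using fib_val_4n_1 by (auto simp: seq_scale_def)
  then have t0: "(\<lambda>n. fib_val (2 * (2 * n) + 1)) \<in> int_seq.span fib_val_gens"
    using base by (simp only: int_seq.span_scale)
  have "(\<lambda>n. fib_val (2 * (2 * n + 1) + 1)) = (\<lambda>n. fib_val (2 * n + 1)) + residue_ind 2"
    using fib_val_4n_3 by (auto simp: algebra_simps numeral_eq_Suc)
  then have t1: "(\<lambda>n. fib_val (2 * (2 * n + 1) + 1)) \<in> int_seq.span fib_val_gens"
    using base by (simp only: int_seq.span_add)
  from assms(2) have "j = 0 \<or> j = 1" by auto
  with assms(1) base t0 t1 show ?thesis
    unfolding fib_val_gens_def
    by (elim insertE emptyE disjE)
       (simp_all only: add_0_right fib_val_even residue_ind_decimation)
qed

lemma fib_val_gens_subset_kernel: "fib_val_gens \<subseteq> k_kernel 2 fib_val"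
proof -
  have mem: "(\<lambda>n. fib_val (2 ^ e * n + i)) \<in> k_kernel 2 fib_val" if "i \<le> 2 ^ e - 1" for e i
    using that by (auto simp: k_kernel_def)
  have r0: "fib_val (Suc (Suc (4 * n))) = residue_ind 0 n" for n
    using fib_val_even[of "2 * n + 1"] residue_ind_decimation(4)[of n] by simp
  have r2: "fib_val (4 * n) = residue_ind 2 n" for n
    using fib_val_even[of "2 * n"] residue_ind_decimation(3)[of n] by simp
  show ?thesis
    \<comment> \<open>The arguments are \<open>i\<close>, then \<open>e\<close>. The instances have
      indices \<open>n\<close>, \<open>2 * n + 1\<close>, \<open>2 * n\<close>, \<open>4 * n\<close>
      and \<open>4 * n + 2\<close>; the last three give \<open>residue_ind\<close> 1, 2 and
      0.\<close>
    using mem[of 0 0] mem[of 1 1] mem[of 0 1] mem[of 0 2] mem[of 2 2]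
    by (simp add: fib_val_gens_def r0 r2 fib_val_even)
qed

text \<open>The kernel lies between the generators and their span, so the two spans agree.\<close>

lemma kernel_module_fib_val: "kernel_module 2 fib_val = int_seq.span fib_val_gens"
proof -
  have "fib_val \<in> int_seq.span fib_val_gens"
    by (rule int_seq.span_base) (simp add: fib_val_gens_def)
  then have "k_kernel 2 fib_val \<subseteq> int_seq.span fib_val_gens"
    by (rule k_kernel_subset_span[rotated]) (auto intro: fib_val_gens_decimation)
  then show ?thesis
    unfolding kernel_module_def
    using fib_val_gens_subset_kernel int_seq.span_mono int_seq.span_minimal int_seq.subspace_span
    by (metis subset_antisym)
qed

section \<open>Linear independence of the generators\<close>

lemma fib_val_values:
  "fib_val 0 = 0" "fib_val 1 = 0" "fib_val 2 = 1" "fib_val 3 = 0" "fib_val 5 = 3"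
  "fib_val 11 = 4" "fib_val 23 = 5"
  using fib_val_even[of 0] fib_val_even[of 1] fib_val_4n_1[of 0] fib_val_4n_1[of 1]
    fib_val_4n_3[of 0] fib_val_4n_3[of 2] fib_val_4n_3[of 5]
  by (simp_all add: residue_ind_def)

lemma card_fib_val_gens: "card fib_val_gens = 5"
  and independent_fib_val_gens: "int_seq.independent fib_val_gens"
proof -
  define t where "t = (\<lambda>n. fib_val (2 * n + 1))"
  have t_values: "t 0 = 0" "t 1 = 0" "t 2 = 3" "t 5 = 4" "t 11 = 5"
    using fib_val_values by (simp_all add: t_def)
  have fin: "finite fib_val_gens" by (simp add: fib_val_gens_def)
  have gens: "fib_val_gens = {fib_val, t, residue_ind 0, residue_ind 1, residue_ind 2}"
    by (simp add: fib_val_gens_def t_def)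
  have "f \<noteq> g" if "f n \<noteq> g n" for f g :: "nat \<Rightarrow> int" and n
    using that by auto
  note neq = this
  have distinct: "fib_val \<noteq> t" "fib_val \<noteq> residue_ind 0" "fib_val \<noteq> residue_ind 1"
    "fib_val \<noteq> residue_ind 2" "t \<noteq> residue_ind 0" "t \<noteq> residue_ind 1" "t \<noteq> residue_ind 2"
    "residue_ind 0 \<noteq> residue_ind 1" "residue_ind 0 \<noteq> residue_ind 2"
    "residue_ind 1 \<noteq> residue_ind 2"
    \<comment> \<open>At 5 the generators take the values 3, 4, 0, 0, 1; the point 0 separates
      \<open>residue_ind 0\<close> from \<open>residue_ind 1\<close>.\<close>
    by (rule neq[of _ 5] neq[of _ 0] neq[of _ 1],
        simp add: fib_val_values t_values residue_ind_def)+
  then show "card fib_val_gens = 5"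
    by (simp add: gens)
  have "\<forall>v\<in>fib_val_gens. u v = 0" if sum0: "(\<Sum>v\<in>fib_val_gens. seq_scale (u v) v) = 0" for u
  proof -
    have "u fib_val * fib_val n + u t * t n + u (residue_ind 0) * residue_ind 0 n
        + u (residue_ind 1) * residue_ind 1 n + u (residue_ind 2) * residue_ind 2 n = 0" for n
      using fun_cong[OF sum0, of n] distinct by (simp add: gens seq_scale_def)
    \<comment> \<open>The points 0 and 1 kill the coefficients of \<open>residue_ind 0\<close> and
      \<open>residue_ind 1\<close>. At 2, 5, 11, all 2 modulo 3, the pair \<open>fib_val\<close>,
      \<open>t\<close> takes the values (1,3), (3,4), (4,5); differences of these equations kill
      both coefficients, and then that of \<open>residue_ind 2\<close>.\<close>
    from this[of 0] this[of 1] this[of 2] this[of 5] this[of 11] show ?thesis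
      by (simp add: gens fib_val_values[simplified] t_values[simplified] residue_ind_def)
  qed
  then show "int_seq.independent fib_val_gens"
    using fin by (auto simp: int_seq.dependent_finite)
qed

theorem theorem3p2:
  shows "k_regular 2 (\<lambda>n. int (multiplicity 2 (fib (n + 1))))
       \<and> seq_rank 2 (\<lambda>n. int (multiplicity 2 (fib (n + 1)))) = 5"
proof -
  have fin: "finite fib_val_gens" by (simp add: fib_val_gens_def)
  have "(\<lambda>n. int (multiplicity 2 (fib (n + 1)))) = fib_val"
    by (auto simp: fib_val_def)
  moreover have "k_regular 2 fib_val"
    using fin kernel_module_fib_val by (auto simp: k_regular_def)
  moreover have "seq_rank 2 fib_val = 5"
    using module_rank_span[OF fin independent_fib_val_gens]
    by (simp add: seq_rank_def kernel_module_fib_val card_fib_val_gens numeral_eq_enat)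
  ultimately show ?thesis by simp
qed

end
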